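(* Let $E$ be the relation on morphisms of $\mathbf{RG}$ consisting of the Euler decomposition $H\stackrel{E}{\equiv} g_{1,1}(1);r_{1,1}(1);g_{1,1}(1)$. For every pair $f\stackrel{E}{\equiv}g$, one has $\mathcal T(f)=\mathcal T(g)$ in $\mathbf{RGB}$ and $[\![f]\!]_{\mathbf{RG}}=[\![g]\!]_{\mathbf{RG}}$ in $\mathbf{Stab}$.
   Context: **Conventions.** All monoidal categories are strict. Composition is written in diagrammatic order: $f;g$ means first $f$, then $g$. $\mathrm{id}$ is the identity on $*$ and $\sigma:*\otimes *\to *\otimes *$ is the symmetry. Phases lie in $C_4=\mathbb Z/4\mathbb Z=\{0,1,2,3\}$. The categories $\mathbf{RG}$ and $\mathbf{RGB}$ are symmetric monoidal categories presented by generators and relations, with objects $*^n$ ($n\ge 0$, $n$-fold monoidal products of one object $*$; $*^0$ is the unit). Morphisms are open directed graphs built from the generators by composition and monoidal product, considered up to graph topology (only connectivity, and the order of the overall inputs and outputs, matters; in particular the legs of a node may be permuted freely), and modulo the listed relations. Connected components of a graph which are connected to neither an input nor an output are ignored (deleted). **Spiders.** Each colour $x$ has generators: unit $x_{0,1}:*^0\to *$, counit $x_{1,0}:*\to *^0$, multiplication $x_{2,1}:*^2\to *$, comultiplication $x_{1,2}:*\to *^2$, phase gates $x_{1,1}(\theta):*\to *$ for $\theta\in C_4$. Write $x_{m,n}(\theta):*^m\to *^n$ for the node obtained by combining $m$ inputs by multiplications (the unit if $m=0$), then applying $x_{1,1}(\theta)$, then producing $n$ outputs by comultiplications (the counit if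 $n=0$). Write $x_{m,n}=x_{m,n}(0)$. The *spider rules* for $x$ are: a node with phase $0$ equals the node with no phase; $x_{1,1}(0)=\mathrm{id}$; and two nodes of colour $x$ with phases $\alpha,\beta$ joined by $k\ge1$ wires fuse: $(x_{m,n+k}(\alpha)\otimes \mathrm{id}_{*^{m'}});(\mathrm{id}_{*^n}\otimes x_{k+m',n'}(\beta))=x_{m+m',n+n'}(\alpha+\beta)$. **Category $\mathbf{RG}$.** Generators: two colours, green $g$ and red $r$, and a gate $H:*\to *$. Relations: - the spider rules for $g$; - $(g_{1,2}\otimes g_{1,2});(\mathrm{id}\otimes\sigma\otimes\mathrm{id});(r_{2,1}\otimes r_{2,1})=r_{2,1};g_{1,2}$; - $r_{0,1};g_{1,2}=r_{0,1}\otimes r_{0,1}$; - $g_{0,2}=r_{0,2}$; - $r_{1,1}(2);g_{1,2}=g_{1,2};(r_{1,1}(2)\otimes r_{1,1}(2))$; - $g_{1,1}(2);r_{1,1}(\theta)=r_{1,1}(-\theta);g_{1,1}(2)$; - $H;H=\mathrm{id}$; - $g_{m,n}(\theta)=H^{\otimes m};r_{m,n}(\theta);H^{\otimes n}$ for all $m,n,\theta$. All equations also hold after reversing all arrows and negating all phases ($\dagger$, with $H$ unchanged), and under exchanging the colours $g$ and $r$. **Category $\mathbf{RGB}$.** Generators: three colours, red $R$, green $G$, blue $B$ (no Hadamard generator). Relations: - the spider rules for $G$; - $B_{0,1};G_{1,2}=B_{0,1}\otimes B_{0,1}$; - $R_{2,1}(3);G_{1,0}=G_{1,0}\otimes G_{1,0}$;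 - $(G_{1,2}\otimes G_{1,2});(\mathrm{id}\otimes\sigma\otimes\mathrm{id});(R_{2,1}(3)\otimes R_{2,1}(3))=R_{2,1}(3);G_{1,2}$; - $(\mathrm{id}\otimes R_{0,1});G_{2,1}=G_{1,1}(1)$; - $G_{1,1}(1);B_{1,1}(1)=R_{1,1}(1);G_{1,1}(1)=B_{1,1}(1);R_{1,1}(1)$; call this morphism $c$ and put $\bar c:=c;c$; - $\bar c^{\otimes m};B_{m,n}(\theta);c^{\otimes n}=G_{m,n}(\theta)=c^{\otimes m};R_{m,n}(\theta);\bar c^{\otimes n}$ for all $m,n,\theta$; - $(\mathrm{id}\otimes G_{0,2});(R_{2,0}\otimes\mathrm{id})=(\mathrm{id}\otimes R_{0,2});(G_{2,0}\otimes\mathrm{id})=R_{1,1}(2)$; - $(\mathrm{id}\otimes B_{0,2});(G_{2,0}\otimes\mathrm{id})=(\mathrm{id}\otimes G_{0,2});(B_{2,0}\otimes\mathrm{id})=G_{1,1}(2)$; - $(\mathrm{id}\otimes R_{0,2});(B_{2,0}\otimes\mathrm{id})=(\mathrm{id}\otimes B_{0,2});(R_{2,0}\otimes\mathrm{id})=B_{1,1}(2)$. All equations also hold after reversing all arrows and negating all phases ($\dagger$), and under even (cyclic) permutations of the three colours. **Translation $\mathcal T:\mathbf{RG}\to\mathbf{RGB}$.** It sends $*$ to $*$, respects composition and monoidal product, and on generators: $g_{1,0}\mapsto G_{1,0}$, $g_{0,1}\mapsto G_{0,1}$, $g_{1,1}(\theta)\mapsto G_{1,1}(\theta)$, $g_{1,2}\mapsto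 G_{1,2}$, $g_{2,1}\mapsto G_{2,1}$; $r_{1,0}\mapsto R_{1,0}(3)$, $r_{0,1}\mapsto R_{0,1}(1)$, $r_{1,1}(\theta)\mapsto R_{1,1}(\theta)$, $r_{1,2}\mapsto R_{1,2}(1)$, $r_{2,1}\mapsto R_{2,1}(3)$; $H\mapsto G_{1,1}(1);R_{1,1}(1);G_{1,1}(1)$. **$\mathbf{Stab}$ and the interpretation.** Let $Q=\mathbb C^2$ with basis $|0\rangle,|1\rangle$ and $|\pm\rangle=(|0\rangle\pm|1\rangle)/\sqrt2$. $\mathbf{Stab}$ is the subcategory, generated under composition and tensor by the single-qubit Clifford unitaries, the map $|0\rangle\mapsto|00\rangle,|1\rangle\mapsto|11\rangle$, and the map $|+\rangle\mapsto1,|-\rangle\mapsto0$ (with adjoints), of the category of the spaces $Q^{\otimes n}$ and linear maps modulo $f\equiv zf$ for $z\in\mathbb C\setminus\{0\}$. The interpretation $[\![\cdot]\!]_{\mathbf{RG}}$ sends $*$ to $Q$, composition to composition of linear maps, monoidal product to tensor product, and on generators (up to nonzero scalar): $g_{0,1}\mapsto|+\rangle$, $g_{1,0}\mapsto\langle+|$, $g_{1,1}(\theta)\mapsto|0\rangle\langle0|+e^{i\frac{\pi}{2}\theta}|1\rangle\langle1|$, $g_{2,1}\mapsto|0\rangle\langle00|+|1\rangle\langle11|$, $g_{1,2}\mapsto|00\rangle\langle0|+|11\rangle\langle1|$; $r_{0,1}\mapsto|0\rangle$, $r_{1,0}\mapsto\langle0|$, $r_{1,1}(\theta)\mapsto|+\rangle\langle+|+e^{i\frac{\pi}{2}\theta}|-\rangle\langle-|$,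 $r_{2,1}\mapsto|+\rangle\langle{+}{+}|+|-\rangle\langle{-}{-}|$, $r_{1,2}\mapsto|{+}{+}\rangle\langle+|+|{-}{-}\rangle\langle-|$; $H\mapsto|+\rangle\langle0|+|-\rangle\langle1|$. *)

theory Defs
  imports
    "Jordan_Normal_Form.Schur_Decomposition"
    "HOL-Library.Numeral_Type"
begin

section \<open>Open graphs as string diagrams\<close>

text \<open>
  Objects are natural numbers: \<open>n\<close> stands for the \<open>n\<close>-fold monoidal product of the single object.
  Composition \<open>f ;; g\<close> is diagrammatic (first \<open>f\<close>, then \<open>g\<close>).  The symmetry is given as the family
  \<open>Swap m n : m + n \<rightarrow> n + m\<close>, so that its naturality can be stated.
\<close>

datatype 'g diag =
    Id nat
  | Swap nat nat
  | Gen 'g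
  | Comp "'g diag" "'g diag"  (infixr ";;" 60)
  | Tens "'g diag" "'g diag"  (infixr "\<boxtimes>" 70)

abbreviation sigma :: "'g diag" where
  "sigma \<equiv> Swap 1 1"

primrec src :: "('g \<Rightarrow> nat \<times> nat) \<Rightarrow> 'g diag \<Rightarrow> nat" where
  "src ar (Id n) = n"
| "src ar (Swap m n) = m + n"
| "src ar (Gen x) = fst (ar x)"
| "src ar (f ;; g) = src ar f"
| "src ar (f \<boxtimes> g) = src ar f + src ar g"

primrec tgt :: "('g \<Rightarrow> nat \<times> nat) \<Rightarrow> 'g diag \<Rightarrow> nat" where
  "tgt ar (Id n) = n"
| "tgt ar (Swap m n) = n + m"
| "tgt ar (Gen x) = snd (ar x)"
| "tgt ar (f ;; g) = tgt ar g"
| "tgt ar (f \<boxtimes> g) = tgt ar f + tgt ar g"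

primrec well_typed :: "('g \<Rightarrow> nat \<times> nat) \<Rightarrow> 'g diag \<Rightarrow> bool" where
  "well_typed ar (Id n) \<longleftrightarrow> True"
| "well_typed ar (Swap m n) \<longleftrightarrow> True"
| "well_typed ar (Gen x) \<longleftrightarrow> True"
| "well_typed ar (f ;; g) \<longleftrightarrow> well_typed ar f \<and> well_typed ar g \<and> tgt ar f = src ar g"
| "well_typed ar (f \<boxtimes> g) \<longleftrightarrow> well_typed ar f \<and> well_typed ar g"

primrec tpow :: "nat \<Rightarrow> 'g diag \<Rightarrow> 'g diag" where
  "tpow 0 f = Id 0"
| "tpow (Suc n) f = f \<boxtimes> tpow n f"

primrec dag :: "('g \<Rightarrow> 'g) \<Rightarrow> 'g diag \<Rightarrow> 'g diag" where
  "dag d (Id n) = Id n"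
| "dag d (Swap m n) = Swap n m"
| "dag d (Gen x) = Gen (d x)"
| "dag d (f ;; g) = dag d g ;; dag d f"
| "dag d (f \<boxtimes> g) = dag d f \<boxtimes> dag d g"

text \<open>
  Equality of morphisms in the strict symmetric monoidal category presented by the generators (with
  arities \<open>ar\<close>) and the relations \<open>R\<close>.  Only well-typed diagrams are related.
\<close>

inductive presented_eq ::
  "('g \<Rightarrow> nat \<times> nat) \<Rightarrow> ('g diag \<Rightarrow> 'g diag \<Rightarrow> bool) \<Rightarrow> 'g diag \<Rightarrow> 'g diag \<Rightarrow> bool"
  for ar R where
  base: "\<lbrakk>R f g; well_typed ar f; well_typed ar g; src ar f = src ar g; tgt ar f = tgt ar g\<rbrakk>
    \<Longrightarrow> presented_eq ar R f g"
| refl: "well_typed ar f \<Longrightarrow> presented_eq ar R f f"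
| sym: "presented_eq ar R f g \<Longrightarrow> presented_eq ar R g f"
| trans: "\<lbrakk>presented_eq ar R f g; presented_eq ar R g h\<rbrakk> \<Longrightarrow> presented_eq ar R f h"
| comp: "\<lbrakk>presented_eq ar R f f'; presented_eq ar R g g'; tgt ar f = src ar g\<rbrakk>
    \<Longrightarrow> presented_eq ar R (f ;; g) (f' ;; g')"
| tens: "\<lbrakk>presented_eq ar R f f'; presented_eq ar R g g'\<rbrakk>
    \<Longrightarrow> presented_eq ar R (f \<boxtimes> g) (f' \<boxtimes> g')"
| comp_assoc: "well_typed ar (f ;; g ;; h) \<Longrightarrow> presented_eq ar R ((f ;; g) ;; h) (f ;; g ;; h)"
| comp_id_left: "well_typed ar f \<Longrightarrow> presented_eq ar R (Id (src ar f) ;; f) f"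
| comp_id_right: "well_typed ar f \<Longrightarrow> presented_eq ar R (f ;; Id (tgt ar f)) f"
| tens_assoc: "well_typed ar (f \<boxtimes> g \<boxtimes> h)
    \<Longrightarrow> presented_eq ar R ((f \<boxtimes> g) \<boxtimes> h) (f \<boxtimes> g \<boxtimes> h)"
| tens_id_left: "well_typed ar f \<Longrightarrow> presented_eq ar R (Id 0 \<boxtimes> f) f"
| tens_id_right: "well_typed ar f \<Longrightarrow> presented_eq ar R (f \<boxtimes> Id 0) f"
| tens_id: "presented_eq ar R (Id m \<boxtimes> Id n) (Id (m + n))"
| interchange: "\<lbrakk>well_typed ar (f ;; g); well_typed ar (f' ;; g')\<rbrakk>
    \<Longrightarrow> presented_eq ar R ((f ;; g) \<boxtimes> (f' ;; g')) ((f \<boxtimes> f') ;; (g \<boxtimes> g'))"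
| swap_natural: "\<lbrakk>well_typed ar f; well_typed ar g\<rbrakk>
    \<Longrightarrow> presented_eq ar R ((f \<boxtimes> g) ;; Swap (tgt ar f) (tgt ar g))
                        (Swap (src ar f) (src ar g) ;; (g \<boxtimes> f))"
| swap_inverse: "presented_eq ar R (Swap m n ;; Swap n m) (Id (m + n))"
| swap_unit: "presented_eq ar R (Swap m 0) (Id m)"
| swap_hexagon: "presented_eq ar R (Swap m (n + p)) ((Swap m n \<boxtimes> Id p) ;; (Id n \<boxtimes> Swap m p))"

section \<open>Spiders\<close>

text \<open>The type \<open>4\<close> of residues modulo 4 is the phase group.\<close>

type_synonym phase = 4

datatype 'c spider = Unit 'c | Counit 'c | Mult 'c | Comult 'c | Phase 'c phase

primrec spider_arity :: "'c spider \<Rightarrow> nat \<times> nat" where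
  "spider_arity (Unit c) = (0, 1)"
| "spider_arity (Counit c) = (1, 0)"
| "spider_arity (Mult c) = (2, 1)"
| "spider_arity (Comult c) = (1, 2)"
| "spider_arity (Phase c \<theta>) = (1, 1)"

primrec spider_dag :: "'c spider \<Rightarrow> 'c spider" where
  "spider_dag (Unit c) = Counit c"
| "spider_dag (Counit c) = Unit c"
| "spider_dag (Mult c) = Comult c"
| "spider_dag (Comult c) = Mult c"
| "spider_dag (Phase c \<theta>) = Phase c (- \<theta>)"

text \<open>Below, \<open>e\<close> embeds the spider generators into the generators of the category at hand.\<close>

fun merge :: "('c spider \<Rightarrow> 'g) \<Rightarrow> 'c \<Rightarrow> nat \<Rightarrow> 'g diag" where
  "merge e c 0 = Gen (e (Unit c))"
| "merge e c (Suc 0) = Id 1"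
| "merge e c (Suc (Suc n)) = (merge e c (Suc n) \<boxtimes> Id 1) ;; Gen (e (Mult c))"

fun split :: "('c spider \<Rightarrow> 'g) \<Rightarrow> 'c \<Rightarrow> nat \<Rightarrow> 'g diag" where
  "split e c 0 = Gen (e (Counit c))"
| "split e c (Suc 0) = Id 1"
| "split e c (Suc (Suc n)) = Gen (e (Comult c)) ;; (split e c (Suc n) \<boxtimes> Id 1)"

definition node :: "('c spider \<Rightarrow> 'g) \<Rightarrow> 'c \<Rightarrow> nat \<Rightarrow> nat \<Rightarrow> phase \<Rightarrow> 'g diag" where
  "node e c m n \<theta> = merge e c m ;; Gen (e (Phase c \<theta>)) ;; split e c n"

inductive spider_rel :: "('c spider \<Rightarrow> 'g) \<Rightarrow> 'c \<Rightarrow> 'g diag \<Rightarrow> 'g diag \<Rightarrow> bool" for e c where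
  no_phase: "spider_rel e c (node e c m n 0) (merge e c m ;; split e c n)"
| phase_zero: "spider_rel e c (node e c 1 1 0) (Id 1)"
| fuse: "k \<ge> 1 \<Longrightarrow>
    spider_rel e c ((node e c m (n + k) \<alpha> \<boxtimes> Id m') ;; (Id n \<boxtimes> node e c (k + m') n' \<beta>))
                   (node e c (m + m') (n + n') (\<alpha> + \<beta>))"

text \<open>
  The symmetric monoidal axioms identify diagrams with the same underlying open graph with ordered
  legs; the following relation makes the legs of each generator unordered.  (For composite nodes
  \<open>node e c m n \<theta>\<close> the corresponding permutation invariance follows with the spider rules.)
\<close>

inductive legs_rel :: "('c spider \<Rightarrow> 'g) \<Rightarrow> 'g diag \<Rightarrow> 'g diag \<Rightarrow> bool" for e where
  "legs_rel e (sigma ;; Gen (e (Mult c))) (Gen (e (Mult c)))"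
| "legs_rel e (Gen (e (Comult c)) ;; sigma) (Gen (e (Comult c)))"

text \<open>Removal of components connected to neither an input nor an output.\<close>

inductive drop_rel :: "('g \<Rightarrow> nat \<times> nat) \<Rightarrow> 'g diag \<Rightarrow> 'g diag \<Rightarrow> bool" for ar where
  "\<lbrakk>well_typed ar f; src ar f = 0; tgt ar f = 0\<rbrakk> \<Longrightarrow> drop_rel ar f (Id 0)"

section \<open>The category RG\<close>

datatype rg_colour = Gn | Rd

datatype rg_gen = Sp "rg_colour spider" | Had

type_synonym rg = "rg_gen diag"

primrec rg_arity :: "rg_gen \<Rightarrow> nat \<times> nat" where
  "rg_arity (Sp s) = spider_arity s"
| "rg_arity Had = (1, 1)"

primrec rg_dag_gen :: "rg_gen \<Rightarrow> rg_gen" where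
  "rg_dag_gen (Sp s) = Sp (spider_dag s)"
| "rg_dag_gen Had = Had"

primrec other :: "rg_colour \<Rightarrow> rg_colour" where
  "other Gn = Rd"
| "other Rd = Gn"

primrec exchange_gen :: "rg_gen \<Rightarrow> rg_gen" where
  "exchange_gen (Sp s) = Sp (map_spider other s)"
| "exchange_gen Had = Had"

abbreviation rg_node :: "rg_colour \<Rightarrow> nat \<Rightarrow> nat \<Rightarrow> phase \<Rightarrow> rg" where
  "rg_node \<equiv> node Sp"

text \<open>Equality of open graphs over the RG generators, before imposing any relation.\<close>

definition rg_graph_eq :: "rg \<Rightarrow> rg \<Rightarrow> bool" where
  "rg_graph_eq = presented_eq rg_arity (legs_rel Sp)"

inductive rg_rel :: "rg \<Rightarrow> rg \<Rightarrow> bool" where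
  legs: "legs_rel Sp f g \<Longrightarrow> rg_rel f g"
| drop: "drop_rel rg_arity f g \<Longrightarrow> rg_rel f g"
| spider: "spider_rel Sp Gn f g \<Longrightarrow> rg_rel f g"
| bialgebra: "rg_rel
    ((rg_node Gn 1 2 0 \<boxtimes> rg_node Gn 1 2 0) ;; (Id 1 \<boxtimes> sigma \<boxtimes> Id 1) ;;
       (rg_node Rd 2 1 0 \<boxtimes> rg_node Rd 2 1 0))
    (rg_node Rd 2 1 0 ;; rg_node Gn 1 2 0)"
| copy: "rg_rel (rg_node Rd 0 1 0 ;; rg_node Gn 1 2 0) (rg_node Rd 0 1 0 \<boxtimes> rg_node Rd 0 1 0)"
| cups: "rg_rel (rg_node Gn 0 2 0) (rg_node Rd 0 2 0)"
| pi_copy: "rg_rel (rg_node Rd 1 1 2 ;; rg_node Gn 1 2 0)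
    (rg_node Gn 1 2 0 ;; (rg_node Rd 1 1 2 \<boxtimes> rg_node Rd 1 1 2))"
| pi_commute: "rg_rel (rg_node Gn 1 1 2 ;; rg_node Rd 1 1 \<theta>) (rg_node Rd 1 1 (- \<theta>) ;; rg_node Gn 1 1 2)"
| had_inv: "rg_rel (Gen Had ;; Gen Had) (Id 1)"
| had_colour: "rg_rel (rg_node Gn m n \<theta>) (tpow m (Gen Had) ;; rg_node Rd m n \<theta> ;; tpow n (Gen Had))"
| dagger: "rg_rel f g \<Longrightarrow> rg_rel (dag rg_dag_gen f) (dag rg_dag_gen g)"
| exchange: "rg_rel f g \<Longrightarrow> rg_rel (map_diag exchange_gen f) (map_diag exchange_gen g)"

definition rg_eq :: "rg \<Rightarrow> rg \<Rightarrow> bool" where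
  "rg_eq = presented_eq rg_arity rg_rel"

lemma rg_graph_eq_imp_rg_eq: "rg_graph_eq f g \<Longrightarrow> rg_eq f g"
  unfolding rg_graph_eq_def rg_eq_def
  by (induction rule: presented_eq.induct) (auto intro: presented_eq.intros rg_rel.legs)

text \<open>
  The Euler decomposition, as a relation on open graphs.  It is not closed under \<^const>\<open>rg_eq\<close>:
  that relation drops isolated components of value 0, such as the green node with no legs and
  phase 2, so the interpretation below is a function of open graphs but not of \<^const>\<open>rg_eq\<close>-classes.
\<close>

definition euler :: "rg \<Rightarrow> rg \<Rightarrow> bool" where
  "euler f g \<longleftrightarrow> rg_graph_eq f (Gen Had) \<and>
     rg_graph_eq g (Gen (Sp (Phase Gn 1)) ;; Gen (Sp (Phase Rd 1)) ;; Gen (Sp (Phase Gn 1)))"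

section \<open>The category RGB\<close>

datatype rgb_colour = Red | Green | Blue

type_synonym rgb = "rgb_colour spider diag"

primrec rotate_colour :: "rgb_colour \<Rightarrow> rgb_colour" where
  "rotate_colour Red = Green"
| "rotate_colour Green = Blue"
| "rotate_colour Blue = Red"

abbreviation rgb_node :: "rgb_colour \<Rightarrow> nat \<Rightarrow> nat \<Rightarrow> phase \<Rightarrow> rgb" where
  "rgb_node \<equiv> node (\<lambda>s. s)"

abbreviation rgb_c :: rgb where
  "rgb_c \<equiv> rgb_node Green 1 1 1 ;; rgb_node Blue 1 1 1"

abbreviation rgb_cbar :: rgb where
  "rgb_cbar \<equiv> rgb_c ;; rgb_c"

inductive rgb_rel :: "rgb \<Rightarrow> rgb \<Rightarrow> bool" where
  legs: "legs_rel (\<lambda>s. s) f g \<Longrightarrow> rgb_rel f g"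
| drop: "drop_rel spider_arity f g \<Longrightarrow> rgb_rel f g"
| spider: "spider_rel (\<lambda>s. s) Green f g \<Longrightarrow> rgb_rel f g"
| copy_blue: "rgb_rel (rgb_node Blue 0 1 0 ;; rgb_node Green 1 2 0)
    (rgb_node Blue 0 1 0 \<boxtimes> rgb_node Blue 0 1 0)"
| cocopy_green: "rgb_rel (rgb_node Red 2 1 3 ;; rgb_node Green 1 0 0)
    (rgb_node Green 1 0 0 \<boxtimes> rgb_node Green 1 0 0)"
| bialgebra: "rgb_rel
    ((rgb_node Green 1 2 0 \<boxtimes> rgb_node Green 1 2 0) ;; (Id 1 \<boxtimes> sigma \<boxtimes> Id 1) ;;
       (rgb_node Red 2 1 3 \<boxtimes> rgb_node Red 2 1 3))
    (rgb_node Red 2 1 3 ;; rgb_node Green 1 2 0)"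
| absorb: "rgb_rel ((Id 1 \<boxtimes> rgb_node Red 0 1 0) ;; rgb_node Green 2 1 0) (rgb_node Green 1 1 1)"
| c_red_green: "rgb_rel rgb_c (rgb_node Red 1 1 1 ;; rgb_node Green 1 1 1)"
| c_blue_red: "rgb_rel (rgb_node Red 1 1 1 ;; rgb_node Green 1 1 1)
    (rgb_node Blue 1 1 1 ;; rgb_node Red 1 1 1)"
| colour_blue: "rgb_rel (tpow m rgb_cbar ;; rgb_node Blue m n \<theta> ;; tpow n rgb_c) (rgb_node Green m n \<theta>)"
| colour_red: "rgb_rel (rgb_node Green m n \<theta>) (tpow m rgb_c ;; rgb_node Red m n \<theta> ;; tpow n rgb_cbar)"
| dual_red_1: "rgb_rel ((Id 1 \<boxtimes> rgb_node Green 0 2 0) ;; (rgb_node Red 2 0 0 \<boxtimes> Id 1))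
    ((Id 1 \<boxtimes> rgb_node Red 0 2 0) ;; (rgb_node Green 2 0 0 \<boxtimes> Id 1))"
| dual_red_2: "rgb_rel ((Id 1 \<boxtimes> rgb_node Red 0 2 0) ;; (rgb_node Green 2 0 0 \<boxtimes> Id 1))
    (rgb_node Red 1 1 2)"
| dual_green_1: "rgb_rel ((Id 1 \<boxtimes> rgb_node Blue 0 2 0) ;; (rgb_node Green 2 0 0 \<boxtimes> Id 1))
    ((Id 1 \<boxtimes> rgb_node Green 0 2 0) ;; (rgb_node Blue 2 0 0 \<boxtimes> Id 1))"
| dual_green_2: "rgb_rel ((Id 1 \<boxtimes> rgb_node Green 0 2 0) ;; (rgb_node Blue 2 0 0 \<boxtimes> Id 1))
    (rgb_node Green 1 1 2)"
| dual_blue_1: "rgb_rel ((Id 1 \<boxtimes> rgb_node Red 0 2 0) ;; (rgb_node Blue 2 0 0 \<boxtimes> Id 1))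
    ((Id 1 \<boxtimes> rgb_node Blue 0 2 0) ;; (rgb_node Red 2 0 0 \<boxtimes> Id 1))"
| dual_blue_2: "rgb_rel ((Id 1 \<boxtimes> rgb_node Blue 0 2 0) ;; (rgb_node Red 2 0 0 \<boxtimes> Id 1))
    (rgb_node Blue 1 1 2)"
| dagger: "rgb_rel f g \<Longrightarrow> rgb_rel (dag spider_dag f) (dag spider_dag g)"
| rotate: "rgb_rel f g \<Longrightarrow>
    rgb_rel (map_diag (map_spider rotate_colour) f) (map_diag (map_spider rotate_colour) g)"

definition rgb_eq :: "rgb \<Rightarrow> rgb \<Rightarrow> bool" where
  "rgb_eq = presented_eq spider_arity rgb_rel"

section \<open>The translation from RG to RGB\<close>

fun translate_gen :: "rg_gen \<Rightarrow> rgb" where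
  "translate_gen (Sp (Counit Gn)) = Gen (Counit Green)"
| "translate_gen (Sp (Unit Gn)) = Gen (Unit Green)"
| "translate_gen (Sp (Phase Gn \<theta>)) = Gen (Phase Green \<theta>)"
| "translate_gen (Sp (Comult Gn)) = Gen (Comult Green)"
| "translate_gen (Sp (Mult Gn)) = Gen (Mult Green)"
| "translate_gen (Sp (Counit Rd)) = rgb_node Red 1 0 3"
| "translate_gen (Sp (Unit Rd)) = rgb_node Red 0 1 1"
| "translate_gen (Sp (Phase Rd \<theta>)) = Gen (Phase Red \<theta>)"
| "translate_gen (Sp (Comult Rd)) = rgb_node Red 1 2 1"
| "translate_gen (Sp (Mult Rd)) = rgb_node Red 2 1 3"
| "translate_gen Had = Gen (Phase Green 1) ;; Gen (Phase Red 1) ;; Gen (Phase Green 1)"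

primrec translate :: "rg \<Rightarrow> rgb" where
  "translate (Id n) = Id n"
| "translate (Swap m n) = Swap m n"
| "translate (Gen x) = translate_gen x"
| "translate (f ;; g) = translate f ;; translate g"
| "translate (f \<boxtimes> g) = translate f \<boxtimes> translate g"

section \<open>Stab and the interpretation of RG\<close>

text \<open>
  A linear map from the \<open>m\<close>-fold to the \<open>n\<close>-fold tensor power of \<open>\<complex>\<^sup>2\<close> is a \<open>2 ^ n \<times> 2 ^ m\<close> matrix in
  the computational basis, ordered with the first tensor factor most significant.
\<close>

definition kron :: "complex mat \<Rightarrow> complex mat \<Rightarrow> complex mat" where
  "kron A B = mat (dim_row A * dim_row B) (dim_col A * dim_col B)
     (\<lambda>(i, j). A $$ (i div dim_row B, j div dim_col B) * B $$ (i mod dim_row B, j mod dim_col B))"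

definition swap_mat :: "nat \<Rightarrow> nat \<Rightarrow> complex mat" where
  "swap_mat m n = mat (2 ^ (n + m)) (2 ^ (m + n))
     (\<lambda>(i, j). if i = (j mod 2 ^ n) * 2 ^ m + j div 2 ^ n then 1 else 0)"

definition ket0 :: "complex mat" where
  "ket0 = mat_of_rows_list 1 [[1], [0]]"

definition ket1 :: "complex mat" where
  "ket1 = mat_of_rows_list 1 [[0], [1]]"

definition ket_plus :: "complex mat" where
  "ket_plus = complex_of_real (1 / sqrt 2) \<cdot>\<^sub>m (ket0 + ket1)"

definition ket_minus :: "complex mat" where
  "ket_minus = complex_of_real (1 / sqrt 2) \<cdot>\<^sub>m (ket0 - ket1)"

abbreviation bra :: "complex mat \<Rightarrow> complex mat" where
  "bra \<equiv> mat_adjoint"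

definition phase_factor :: "phase \<Rightarrow> complex" where
  "phase_factor \<theta> = exp (\<i> * complex_of_real (pi / 2) * of_int (Rep_bit0 \<theta>))"

fun interp_gen :: "rg_gen \<Rightarrow> complex mat" where
  "interp_gen (Sp (Unit Gn)) = ket_plus"
| "interp_gen (Sp (Counit Gn)) = bra ket_plus"
| "interp_gen (Sp (Phase Gn \<theta>)) = ket0 * bra ket0 + phase_factor \<theta> \<cdot>\<^sub>m (ket1 * bra ket1)"
| "interp_gen (Sp (Mult Gn)) = ket0 * bra (kron ket0 ket0) + ket1 * bra (kron ket1 ket1)"
| "interp_gen (Sp (Comult Gn)) = kron ket0 ket0 * bra ket0 + kron ket1 ket1 * bra ket1"
| "interp_gen (Sp (Unit Rd)) = ket0"
| "interp_gen (Sp (Counit Rd)) = bra ket0"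
| "interp_gen (Sp (Phase Rd \<theta>)) =
     ket_plus * bra ket_plus + phase_factor \<theta> \<cdot>\<^sub>m (ket_minus * bra ket_minus)"
| "interp_gen (Sp (Mult Rd)) =
     ket_plus * bra (kron ket_plus ket_plus) + ket_minus * bra (kron ket_minus ket_minus)"
| "interp_gen (Sp (Comult Rd)) =
     kron ket_plus ket_plus * bra ket_plus + kron ket_minus ket_minus * bra ket_minus"
| "interp_gen Had = ket_plus * bra ket0 + ket_minus * bra ket1"

primrec interp :: "rg \<Rightarrow> complex mat" where
  "interp (Id n) = 1\<^sub>m (2 ^ n)"
| "interp (Swap m n) = swap_mat m n"
| "interp (Gen x) = interp_gen x"
| "interp (f ;; g) = interp g * interp f"
| "interp (f \<boxtimes> g) = kron (interp f) (interp g)"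

definition pauli :: "complex mat set" where
  "pauli = {mat_of_rows_list 2 [[0, 1], [1, 0]],
            mat_of_rows_list 2 [[0, - \<i>], [\<i>, 0]],
            mat_of_rows_list 2 [[1, 0], [0, - 1]]}"

definition clifford1 :: "complex mat \<Rightarrow> bool" where
  "clifford1 U \<longleftrightarrow> U \<in> carrier_mat 2 2 \<and> U * mat_adjoint U = 1\<^sub>m 2 \<and>
     (\<forall>P\<in>pauli. \<exists>Q\<in>pauli. U * P * mat_adjoint U = Q \<or> U * P * mat_adjoint U = - Q)"

text \<open>
  \<open>stab m n M\<close>: the class of \<open>M\<close> modulo nonzero scalars is a morphism \<open>m \<rightarrow> n\<close> of Stab.
  The counit is \<open>bra ket_plus\<close>, sending \<open>ket_plus\<close> to 1 and \<open>ket_minus\<close> to 0.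
\<close>

inductive stab :: "nat \<Rightarrow> nat \<Rightarrow> complex mat \<Rightarrow> bool" where
  clifford: "clifford1 U \<Longrightarrow> stab 1 1 U"
| copy: "stab 1 2 (kron ket0 ket0 * bra ket0 + kron ket1 ket1 * bra ket1)"
| counit: "stab 1 0 (bra ket_plus)"
| adjoint: "stab m n M \<Longrightarrow> stab n m (mat_adjoint M)"
| ident: "stab n n (1\<^sub>m (2 ^ n))"
| comp: "\<lbrakk>stab m n M; stab n p N\<rbrakk> \<Longrightarrow> stab m p (N * M)"
| tens: "\<lbrakk>stab m n M; stab m' n' M'\<rbrakk> \<Longrightarrow> stab (m + m') (n + n') (kron M M')"
| scale: "\<lbrakk>stab m n M; z \<noteq> 0\<rbrakk> \<Longrightarrow> stab m n (z \<cdot>\<^sub>m M)"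

definition stab_eq :: "nat \<Rightarrow> nat \<Rightarrow> complex mat \<Rightarrow> complex mat \<Rightarrow> bool" where
  "stab_eq m n M N \<longleftrightarrow> stab m n M \<and> stab m n N \<and> (\<exists>z. z \<noteq> 0 \<and> M = z \<cdot>\<^sub>m N)"

end

theory Submission
  imports Defs
begin

text \<open>
  The Euler relation only contains diagrams that are graph-equal to the Hadamard gate on one side and
  to green-red-green quarter turns on the other.  So two things suffice: both the translation and the
  interpretation are well defined on open graphs, and both identify these two particular diagrams.

  Well-definedness is an induction over the axioms of symmetric monoidal categories together with the
  permutation of legs.  For the translation (\<open>rgb_eq_translate\<close>) the monoidal axioms hold in the target
  because the translation preserves types; the one genuine case is the permutation of the legs of a
  red multiplication or comultiplication, which is translated to a red node with a phase.  The phase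
  sits at the single leg, away from the two permuted ones, so the bare generator inside the node
  still absorbs the permutation.  For the interpretation (\<open>interp_rg_graph_eq\<close>) graph equality becomes equality of
  matrices on the nose, without any scalar: Kronecker products satisfy the monoidal axioms by
  arithmetic of quotients and remainders of indices, and the symmetry is the permutation matrix that
  exchanges the two digits of a mixed-radix index.

  The translation sends the Hadamard gate to the translation of its Euler decomposition literally.
  As matrices, the decomposition is the Hadamard matrix times the scalar
  \<open>(1 + \<i>) / \<surd>2\<close> (\<open>interp_euler\<close>); the Hadamard matrix is a Clifford unitary
  (\<open>clifford1_had\<close>), so both sides are morphisms of Stab.
\<close>

section \<open>Typing\<close>

lemma presented_eq_typed:
  assumes "presented_eq ar R f g"
  shows "well_typed ar f \<and> well_typed ar g \<and> src ar f = src ar g \<and> tgt ar f = tgt ar g"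
  using assms by induction auto

section \<open>Invariance of the translation\<close>

lemmas [trans] = presented_eq.trans

lemma arity_translate_gen:
  "src spider_arity (translate_gen x) = fst (rg_arity x)
     \<and> tgt spider_arity (translate_gen x) = snd (rg_arity x)
     \<and> well_typed spider_arity (translate_gen x)"
  by (cases x rule: translate_gen.cases) (auto simp: node_def numeral_2_eq_2)

lemma src_translate [simp]: "src spider_arity (translate f) = src rg_arity f"
  and tgt_translate [simp]: "tgt spider_arity (translate f) = tgt rg_arity f"
  by (induction f) (simp_all add: arity_translate_gen)

lemma well_typed_translate [simp]:
  "well_typed rg_arity f \<Longrightarrow> well_typed spider_arity (translate f)"
  by (induction f) (simp_all add: arity_translate_gen)

text \<open>
  By its recursive definition, merging two wires is the multiplication preceded by two parallel
  identity wires rather than by the identity on two wires; this lemma and its mirror image remove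
  that padding.
\<close>

lemma presented_eq_Id_Id_comp:
  assumes "well_typed ar h" and "src ar h = 2"
  shows "presented_eq ar R ((Id 1 \<boxtimes> Id 1) ;; h) h"
proof -
  have "presented_eq ar R (Id 1 \<boxtimes> Id 1) (Id 2)"
    using presented_eq.tens_id[of ar R 1 1] by (simp add: numeral_2_eq_2)
  then have "presented_eq ar R ((Id 1 \<boxtimes> Id 1) ;; h) (Id 2 ;; h)"
    using assms by (intro presented_eq.comp presented_eq.refl) simp_all
  also have "presented_eq ar R (Id 2 ;; h) h"
    using presented_eq.comp_id_left[of ar h R] assms by simp
  finally show ?thesis .
qed

lemma presented_eq_comp_Id_Id:
  assumes "well_typed ar h" and "tgt ar h = 2"
  shows "presented_eq ar R (h ;; (Id 1 \<boxtimes> Id 1)) h"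
proof -
  have "presented_eq ar R (Id 1 \<boxtimes> Id 1) (Id 2)"
    using presented_eq.tens_id[of ar R 1 1] by (simp add: numeral_2_eq_2)
  then have "presented_eq ar R (h ;; (Id 1 \<boxtimes> Id 1)) (h ;; Id 2)"
    using assms by (intro presented_eq.comp presented_eq.refl) simp_all
  also have "presented_eq ar R (h ;; Id 2) h"
    using presented_eq.comp_id_right[of ar h R] assms by simp
  finally show ?thesis .
qed

text \<open>
  The symmetry meets the bare multiplication first, before the phase of the node, so it is absorbed by
  the leg rule of the generator and the rest of the node is carried along.
\<close>

lemma rgb_eq_sigma_node:
  "rgb_eq (sigma ;; rgb_node c 2 1 \<theta>) (rgb_node c 2 1 \<theta>)"
proof -
  let ?E = "presented_eq spider_arity rgb_rel"
  let ?M = "Gen (Mult c) :: rgb" and ?I = "(Id 1 \<boxtimes> Id 1) :: rgb"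
  let ?P = "Gen (Phase c \<theta>) ;; Id 1 :: rgb"
  have unit: "?E (?I ;; ?M) ?M"
    by (rule presented_eq_Id_Id_comp) simp_all
  have "?E (sigma ;; (?I ;; ?M)) (sigma ;; ?M)"
    using unit by (intro presented_eq.comp presented_eq.refl) simp_all
  also have "?E (sigma ;; ?M) ?M"
    by (intro presented_eq.base rgb_rel.legs legs_rel.intros) simp_all
  also have "?E ?M (?I ;; ?M)"
    using unit by (rule presented_eq.sym)
  finally have swap: "?E (sigma ;; (?I ;; ?M)) (?I ;; ?M)" .
  have "?E (sigma ;; (?I ;; ?M) ;; ?P) ((sigma ;; (?I ;; ?M)) ;; ?P)"
    by (intro presented_eq.sym[OF presented_eq.comp_assoc]) simp
  also have "?E ((sigma ;; (?I ;; ?M)) ;; ?P) ((?I ;; ?M) ;; ?P)"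
    by (rule presented_eq.comp[OF swap presented_eq.refl]) simp_all
  finally show ?thesis
    by (simp add: rgb_eq_def node_def numeral_2_eq_2)
qed

lemma rgb_eq_node_sigma:
  "rgb_eq (rgb_node c 1 2 \<theta> ;; sigma) (rgb_node c 1 2 \<theta>)"
proof -
  let ?E = "presented_eq spider_arity rgb_rel"
  let ?M = "Gen (Comult c) :: rgb" and ?I = "(Id 1 \<boxtimes> Id 1) :: rgb"
  let ?P = "Gen (Phase c \<theta>) :: rgb"
  have unit: "?E (?M ;; ?I) ?M"
    by (rule presented_eq_comp_Id_Id) simp_all
  have "?E ((?M ;; ?I) ;; sigma) (?M ;; sigma)"
    using unit by (intro presented_eq.comp presented_eq.refl) simp_all
  also have "?E (?M ;; sigma) ?M"
    by (intro presented_eq.base rgb_rel.legs legs_rel.intros) simp_all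
  also have "?E ?M (?M ;; ?I)"
    using unit by (rule presented_eq.sym)
  finally have swap: "?E ((?M ;; ?I) ;; sigma) (?M ;; ?I)" .
  have "?E ((Id 1 ;; ?P ;; (?M ;; ?I)) ;; sigma) (Id 1 ;; (?P ;; (?M ;; ?I)) ;; sigma)"
    by (intro presented_eq.comp_assoc) simp
  also have "?E \<dots> (Id 1 ;; ?P ;; (?M ;; ?I) ;; sigma)"
    by (intro presented_eq.comp presented_eq.refl presented_eq.comp_assoc) simp_all
  also have "?E \<dots> (Id 1 ;; ?P ;; (?M ;; ?I))"
    by (rule presented_eq.comp[OF presented_eq.refl presented_eq.comp[OF presented_eq.refl swap]])
       simp_all
  finally show ?thesis
    by (simp add: rgb_eq_def node_def numeral_2_eq_2)
qed

lemma rgb_eq_translate_legs: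
  assumes "legs_rel Sp f g"
  shows "rgb_eq (translate f) (translate g)"
  using assms
proof cases
  case (1 c)
  show ?thesis
  proof (cases c)
    case Gn
    with 1 show ?thesis
      unfolding rgb_eq_def
      by (auto intro!: presented_eq.base rgb_rel.legs legs_rel.intros[of "\<lambda>s. s" Green, simplified])
  next
    case Rd
    with 1 show ?thesis by (simp add: rgb_eq_sigma_node[simplified])
  qed
next
  case (2 c)
  show ?thesis
  proof (cases c)
    case Gn
    with 2 show ?thesis
      unfolding rgb_eq_def
      by (auto intro!: presented_eq.base rgb_rel.legs legs_rel.intros[of "\<lambda>s. s" Green, simplified])
  next
    case Rd
    with 2 show ?thesis by (simp add: rgb_eq_node_sigma[simplified])
  qed
qed

lemma rgb_eq_translate:
  assumes "rg_graph_eq f g"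
  shows "rgb_eq (translate f) (translate g)"
  using assms unfolding rg_graph_eq_def
proof induction
  case (base f g)
  then show ?case by (intro rgb_eq_translate_legs)
next
  case (comp_id_left f)
  then show ?case
    using presented_eq.comp_id_left[of spider_arity "translate f" rgb_rel] by (simp add: rgb_eq_def)
next
  case (comp_id_right f)
  then show ?case
    using presented_eq.comp_id_right[of spider_arity "translate f" rgb_rel] by (simp add: rgb_eq_def)
next
  case (swap_natural f g)
  then show ?case
    using presented_eq.swap_natural[of spider_arity "translate f" "translate g" rgb_rel]
    by (simp add: rgb_eq_def)
next
  case (trans f g h)
  then show ?case unfolding rgb_eq_def by (blast intro: presented_eq.trans)
qed (auto simp: rgb_eq_def intro: presented_eq.intros(2,3,5-))

section \<open>Kronecker products of matrices\<close>

lemma index_mult_mat_sum: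
  assumes "i < dim_row A" and "j < dim_col B" and "dim_col A = dim_row B"
  shows "(A * B) $$ (i, j) = (\<Sum>k<dim_row B. A $$ (i, k) * B $$ (k, j))"
  using assms by (simp add: scalar_prod_def lessThan_atLeast0)

lemma dim_kron [simp]:
  "dim_row (kron A B) = dim_row A * dim_row B"
  "dim_col (kron A B) = dim_col A * dim_col B"
  by (simp_all add: kron_def)

lemma index_kron [simp]:
  assumes "i < dim_row A * dim_row B" and "j < dim_col A * dim_col B"
  shows "kron A B $$ (i, j)
    = A $$ (i div dim_row B, j div dim_col B) * B $$ (i mod dim_row B, j mod dim_col B)"
  using assms by (simp add: kron_def)

lemma mod_less_of_less_mult: "(i :: nat) < a * b \<Longrightarrow> i mod b < b"
  by (metis bot_nat_0.not_eq_extremum mod_less_divisor mult_0_right not_less_zero)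

lemma sum_div_mod:
  fixes f :: "nat \<Rightarrow> nat \<Rightarrow> 'a :: comm_monoid_add"
  shows "(\<Sum>k<m * n. f (k div n) (k mod n)) = (\<Sum>i<m. \<Sum>j<n. f i j)"
proof -
  have bound: "i * n + j < m * n" if "i < m" "j < n" for i j
  proof -
    have "i * n + j < Suc i * n" using that by simp
    also have "\<dots> \<le> m * n" using that by (intro mult_right_mono) simp_all
    finally show ?thesis .
  qed
  have "(\<Sum>k<m * n. f (k div n) (k mod n)) = (\<Sum>(i, j)\<in>{..<m} \<times> {..<n}. f i j)"
    by (rule sum.reindex_bij_witness[of _ "\<lambda>(i, j). i * n + j" "\<lambda>k. (k div n, k mod n)"])
       (auto simp: less_mult_imp_div_less mod_less_of_less_mult bound)
  then show ?thesis by (simp add: sum.cartesian_product)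
qed

text \<open>
  The sum over the inner index factors into a sum over quotients times a sum over remainders.  This is
  the interchange law of the tensor product.
\<close>

lemma kron_mult:
  assumes "dim_col A = dim_row C" and "dim_col B = dim_row D"
  shows "kron A B * kron C D = kron (A * C) (B * D)"
proof (rule eq_matI)
  fix i j
  assume "i < dim_row (kron (A * C) (B * D))" and "j < dim_col (kron (A * C) (B * D))"
  then have i: "i < dim_row A * dim_row B" and j: "j < dim_col C * dim_col D" by simp_all
  note bounds = i j less_mult_imp_div_less[OF i] less_mult_imp_div_less[OF j]
    mod_less_of_less_mult[OF i] mod_less_of_less_mult[OF j]
  let ?a = "\<lambda>k. A $$ (i div dim_row B, k) * C $$ (k, j div dim_col D)"
  let ?b = "\<lambda>k. B $$ (i mod dim_row B, k) * D $$ (k, j mod dim_col D)"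
  have "(kron A B * kron C D) $$ (i, j)
      = (\<Sum>k<dim_row C * dim_row D. kron A B $$ (i, k) * kron C D $$ (k, j))"
    using bounds assms by (subst index_mult_mat_sum) simp_all
  also have "\<dots> = (\<Sum>k<dim_row C * dim_row D. ?a (k div dim_row D) * ?b (k mod dim_row D))"
    using bounds assms by (intro sum.cong) simp_all
  also have "\<dots> = (\<Sum>k<dim_row C. \<Sum>l<dim_row D. ?a k * ?b l)"
    by (rule sum_div_mod)
  also have "\<dots> = (\<Sum>k<dim_row C. ?a k) * (\<Sum>l<dim_row D. ?b l)"
    by (simp only: sum_product)
  also have "\<dots> = kron (A * C) (B * D) $$ (i, j)"
    using bounds assms by (simp add: index_mult_mat_sum del: index_mult_mat(1))
  finally show "(kron A B * kron C D) $$ (i, j) = kron (A * C) (B * D) $$ (i, j)" .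
qed simp_all

lemma kron_assoc: "kron (kron A B) C = kron A (kron B C)"
proof (rule eq_matI)
  fix i j
  assume "i < dim_row (kron A (kron B C))" and "j < dim_col (kron A (kron B C))"
  then have i: "i < dim_row A * dim_row B * dim_row C" and j: "j < dim_col A * dim_col B * dim_col C"
    by (simp_all add: mult.assoc)
  have i': "i < dim_row A * (dim_row B * dim_row C)" and j': "j < dim_col A * (dim_col B * dim_col C)"
    using i j by (simp_all add: mult.assoc)
  have div_mod: "k mod (b * c) div c = k div c mod b" "k mod (b * c) mod c = k mod c"
    "k div (b * c) = k div c div b" if "k < a * b * c" for a b c k :: nat
    using that by (cases "c = 0"; simp add: mod_mult2_eq[of k c b] div_mult2_eq[of k c b] mult.commute[of b c])+
  show "kron (kron A B) C $$ (i, j) = kron A (kron B C) $$ (i, j)"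
    using i j i' j' less_mult_imp_div_less[OF i] less_mult_imp_div_less[OF j]
      mod_less_of_less_mult[OF i'] mod_less_of_less_mult[OF j']
    by (simp add: div_mod[OF i] div_mod[OF j])
qed (simp_all add: mult.assoc)

lemma kron_one_left [simp]: "kron (1\<^sub>m (Suc 0)) A = A"
  by (rule eq_matI) simp_all

lemma kron_one_right [simp]: "kron A (1\<^sub>m (Suc 0)) = A"
  by (rule eq_matI) simp_all

section \<open>Permutation matrices and the symmetry\<close>

definition perm_mat :: "nat \<Rightarrow> (nat \<Rightarrow> nat) \<Rightarrow> complex mat" where
  "perm_mat N s = mat N N (\<lambda>(i, j). if i = s j then 1 else 0)"

lemma dim_perm_mat [simp]: "dim_row (perm_mat N s) = N" "dim_col (perm_mat N s) = N"
  by (simp_all add: perm_mat_def)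

lemma index_perm_mat [simp]:
  "i < N \<Longrightarrow> j < N \<Longrightarrow> perm_mat N s $$ (i, j) = (if i = s j then 1 else 0)"
  by (simp add: perm_mat_def)

lemma perm_mat_cong: "(\<And>j. j < N \<Longrightarrow> s j = t j) \<Longrightarrow> perm_mat N s = perm_mat N t"
  by (rule eq_matI) simp_all

lemma perm_mat_id: "1\<^sub>m N = perm_mat N (\<lambda>j. j)"
  by (rule eq_matI) simp_all

lemma index_mult_perm_mat:
  assumes "dim_col A = N" and "i < dim_row A" and "j < N" and "s j < N"
  shows "(A * perm_mat N s) $$ (i, j) = A $$ (i, s j)"
proof -
  have "(A * perm_mat N s) $$ (i, j) = (\<Sum>k<N. A $$ (i, k) * perm_mat N s $$ (k, j))"
    using assms by (subst index_mult_mat_sum) simp_all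
  also have "\<dots> = (\<Sum>k<N. if k = s j then A $$ (i, k) else 0)"
    using assms by (intro sum.cong) auto
  finally show ?thesis using assms by simp
qed

lemma index_perm_mat_mult:
  assumes "dim_row A = N" and "i < N" and "j < dim_col A" and "i' < N"
    and "\<And>k. k < N \<Longrightarrow> i = s k \<longleftrightarrow> k = i'"
  shows "(perm_mat N s * A) $$ (i, j) = A $$ (i', j)"
proof -
  have "(perm_mat N s * A) $$ (i, j) = (\<Sum>k<N. perm_mat N s $$ (i, k) * A $$ (k, j))"
    using assms by (subst index_mult_mat_sum) simp_all
  also have "\<dots> = (\<Sum>k<N. if k = i' then A $$ (k, j) else 0)"
    using assms by (intro sum.cong) auto
  finally show ?thesis using assms by simp
qed

lemma perm_mat_mult:
  assumes "\<And>j. j < N \<Longrightarrow> t j < N"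
  shows "perm_mat N s * perm_mat N t = perm_mat N (\<lambda>j. s (t j))"
  using assms by (intro eq_matI) (simp_all add: index_mult_perm_mat del: index_mult_mat(1))

text \<open>
  The quotient is moved by \<open>s\<close> and the remainder by \<open>t\<close>.  The bound on \<open>t\<close> keeps the new remainder
  below \<open>N\<close>, so that it can be read off from the new index.
\<close>

lemma kron_perm_mat:
  assumes "\<And>j. j < N \<Longrightarrow> t j < N"
  shows "kron (perm_mat M s) (perm_mat N t)
    = perm_mat (M * N) (\<lambda>j. s (j div N) * N + t (j mod N))"
proof (rule eq_matI, goal_cases)
  case (1 i j)
  then have i: "i < M * N" and j: "j < M * N" by simp_all
  note bounds = i j less_mult_imp_div_less[OF i] less_mult_imp_div_less[OF j]
    mod_less_of_less_mult[OF i] mod_less_of_less_mult[OF j]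
  have t: "t (j mod N) < N" using assms bounds by blast
  have "i = s (j div N) * N + t (j mod N) \<longleftrightarrow> i div N = s (j div N) \<and> i mod N = t (j mod N)"
    using t by (auto simp: div_mult_mod_eq) (metis div_mult_mod_eq)
  then show ?case using bounds by simp
qed simp_all

text \<open>
  An index below \<open>a * b\<close> is written \<open>x * b + y\<close> with \<open>x < a\<close> and \<open>y < b\<close>; the swap sends it to
  \<open>y * a + x\<close>.  Sizes are arbitrary rather than powers of two so that naturality covers
  arbitrary rectangular matrices.
\<close>

definition swap_index :: "nat \<Rightarrow> nat \<Rightarrow> nat \<Rightarrow> nat" where
  "swap_index a b j = (j mod b) * a + j div b"

lemma swap_index_div:
  assumes "j < a * b"
  shows "swap_index a b j div a = j mod b"
  using less_mult_imp_div_less[OF assms] by (simp add: swap_index_def)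

lemma swap_index_mod:
  assumes "j < a * b"
  shows "swap_index a b j mod a = j div b"
  using less_mult_imp_div_less[OF assms] by (simp add: swap_index_def)

lemma swap_index_inverse:
  assumes "j < a * b"
  shows "swap_index b a (swap_index a b j) = j"
  using swap_index_div[OF assms] swap_index_mod[OF assms]
  by (simp add: swap_index_def[of b a])

lemma swap_index_less:
  assumes "j < a * b"
  shows "swap_index a b j < a * b"
proof -
  have "(j mod b) * a + j div b < Suc (j mod b) * a"
    using less_mult_imp_div_less[OF assms] by simp
  also have "\<dots> \<le> b * a"
    using mod_less_of_less_mult[OF assms] by (intro mult_right_mono) simp_all
  finally show ?thesis by (simp add: swap_index_def mult.commute)
qed

lemma swap_mat_eq_perm_mat: "swap_mat m n = perm_mat (2 ^ m * 2 ^ n) (swap_index (2 ^ m) (2 ^ n))"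
  by (rule eq_matI) (simp_all add: swap_mat_def swap_index_def power_add mult.commute)

text \<open>
  Both sides have the entry \<open>F $$ (i mod a', j div b) * G $$ (i div a', j mod b)\<close>: on the left the row
  index is moved back through the swap, on the right the column index is moved forward.
\<close>

lemma swap_natural_mat:
  assumes F: "dim_row F = a'" "dim_col F = a" and G: "dim_row G = b'" "dim_col G = b"
  shows "perm_mat (a' * b') (swap_index a' b') * kron F G
    = kron G F * perm_mat (a * b) (swap_index a b)"
proof (rule eq_matI, goal_cases)
  case (1 i j)
  then have i: "i < b' * a'" and j: "j < a * b" using F G by simp_all
  have i': "i < a' * b'" using i by (simp add: mult.commute)
  have inv: "i = swap_index a' b' k \<longleftrightarrow> k = swap_index b' a' i" if "k < a' * b'" for k
    using swap_index_inverse[OF that] swap_index_inverse[OF i] by auto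
  have less: "swap_index b' a' i < a' * b'" using swap_index_less[OF i] by (simp add: mult.commute)
  have less': "swap_index a b j < b * a" using swap_index_less[OF j] by (simp add: mult.commute)
  have "(perm_mat (a' * b') (swap_index a' b') * kron F G) $$ (i, j)
      = kron F G $$ (swap_index b' a' i, j)"
    using F G i' j less inv by (intro index_perm_mat_mult) simp_all
  also have "\<dots> = F $$ (i mod a', j div b) * G $$ (i div a', j mod b)"
    using F G j less by (simp add: swap_index_div[OF i] swap_index_mod[OF i])
  also have "\<dots> = kron G F $$ (i, swap_index a b j)"
    using F G i less' by (simp add: swap_index_div[OF j] swap_index_mod[OF j])
  also have "\<dots> = (kron G F * perm_mat (a * b) (swap_index a b)) $$ (i, j)"
    using F G i j less' by (subst index_mult_perm_mat) (simp_all add: mult.commute)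
  finally show ?case .
qed (use F G in \<open>simp_all add: mult.commute\<close>)

lemma swap_mat_inverse: "swap_mat n m * swap_mat m n = 1\<^sub>m (2 ^ (m + n))"
proof -
  let ?a = "2 ^ m :: nat" and ?b = "2 ^ n :: nat"
  have "swap_mat n m * swap_mat m n
      = perm_mat (?a * ?b) (\<lambda>j. swap_index ?b ?a (swap_index ?a ?b j))"
    unfolding swap_mat_eq_perm_mat mult.commute[of ?b ?a]
    by (intro perm_mat_mult swap_index_less)
  also have "\<dots> = perm_mat (?a * ?b) (\<lambda>j. j)"
    by (intro perm_mat_cong swap_index_inverse)
  finally show ?thesis by (simp add: perm_mat_id power_add)
qed

lemma swap_mat_unit: "swap_mat m 0 = 1\<^sub>m (2 ^ m)"
  by (rule eq_matI) (simp_all add: swap_mat_def)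

text \<open>
  In three digits \<open>j = (x * b + y) * c + z\<close>.  The intermediate index \<open>u\<close> has the digits
  \<open>y, x, z\<close>, and both sides end with the digits \<open>y, z, x\<close>.
\<close>

lemma swap_index_hexagon:
  assumes j: "j < a * b * c"
  shows "swap_index a (b * c) j = (let u = swap_index a b (j div c) * c + j mod c
    in u div (a * c) * (a * c) + swap_index a c (u mod (a * c)))"
proof -
  define x y z where "x = j div c div b" and "y = j div c mod b" and "z = j mod c"
  have j': "j div c < a * b" using j by (rule less_mult_imp_div_less)
  have xyz: "x < a" "y < b" "z < c"
    unfolding x_def y_def z_def
    using less_mult_imp_div_less[OF j'] mod_less_of_less_mult[OF j'] mod_less_of_less_mult[OF j]
    by simp_all
  have mod: "j mod (b * c) = y * c + z" and div: "j div (b * c) = x"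
    by (simp_all add: x_def y_def z_def mod_mult2_eq[of j c b] div_mult2_eq[of j c b]
        mult.commute[of b c])
  have 1: "x * c + z < a * c"
  proof -
    have "x * c + z < Suc x * c" using xyz by simp
    also have "\<dots> \<le> a * c" using xyz by (intro mult_right_mono) simp_all
    finally show ?thesis .
  qed
  have u: "swap_index a b (j div c) * c + j mod c = y * (a * c) + (x * c + z)"
    by (simp add: swap_index_def x_def y_def z_def algebra_simps)
  have "swap_index a c (x * c + z) = z * a + x"
    using xyz by (simp add: swap_index_def)
  moreover have "(y * (a * c) + (x * c + z)) div (a * c) = y"
    "(y * (a * c) + (x * c + z)) mod (a * c) = x * c + z"
  proof -
    have "(y * k + w) div k = y \<and> (y * k + w) mod k = w" if "w < k" for k w :: nat
      using that by simp
    from this[OF 1] show "(y * (a * c) + (x * c + z)) div (a * c) = y"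
      "(y * (a * c) + (x * c + z)) mod (a * c) = x * c + z" by blast+
  qed
  moreover have "swap_index a (b * c) j = (y * c + z) * a + x"
    by (simp only: swap_index_def mod div)
  ultimately show ?thesis
    unfolding u Let_def by (simp add: algebra_simps)
qed

lemma swap_mat_hexagon:
  "swap_mat m (n + p) = kron (1\<^sub>m (2 ^ n)) (swap_mat m p) * kron (swap_mat m n) (1\<^sub>m (2 ^ p))"
proof -
  let ?a = "2 ^ m :: nat" and ?b = "2 ^ n :: nat" and ?c = "2 ^ p :: nat"
  let ?s = "\<lambda>j. swap_index ?a ?b (j div ?c) * ?c + j mod ?c"
  let ?t = "\<lambda>u. u div (?a * ?c) * (?a * ?c) + swap_index ?a ?c (u mod (?a * ?c))"
  have first: "kron (swap_mat m n) (1\<^sub>m ?c) = perm_mat (?a * ?b * ?c) ?s"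
    unfolding swap_mat_eq_perm_mat perm_mat_id by (subst kron_perm_mat) simp_all
  have second: "kron (1\<^sub>m ?b) (swap_mat m p) = perm_mat (?a * ?b * ?c) ?t"
    unfolding swap_mat_eq_perm_mat perm_mat_id
    by (subst kron_perm_mat) (simp_all add: swap_index_less mult_ac)
  have bound: "?s j < ?a * ?b * ?c" if "j < ?a * ?b * ?c" for j
  proof -
    have "?s j < Suc (swap_index ?a ?b (j div ?c)) * ?c" by simp
    also have "\<dots> \<le> ?a * ?b * ?c"
      using swap_index_less[OF less_mult_imp_div_less[OF that]] by (intro mult_right_mono) simp_all
    finally show ?thesis .
  qed
  have "kron (1\<^sub>m ?b) (swap_mat m p) * kron (swap_mat m n) (1\<^sub>m ?c)
      = perm_mat (?a * ?b * ?c) (\<lambda>j. ?t (?s j))"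
    unfolding first second by (rule perm_mat_mult) (rule bound)
  also have "\<dots> = perm_mat (?a * ?b * ?c) (swap_index ?a (?b * ?c))"
    by (rule perm_mat_cong) (simp add: swap_index_hexagon Let_def)
  finally show ?thesis by (simp add: swap_mat_eq_perm_mat power_add mult.assoc)
qed

section \<open>Invariance of the interpretation\<close>

lemma dim_mat_adjoint [simp]:
  "dim_row (mat_adjoint A) = dim_col A" "dim_col (mat_adjoint A) = dim_row A"
  by (simp_all add: mat_adjoint_def)

lemma index_mat_adjoint [simp]:
  "i < dim_col A \<Longrightarrow> j < dim_row A \<Longrightarrow> mat_adjoint A $$ (i, j) = conjugate (A $$ (j, i))"
  by (simp add: mat_adjoint_def mat_of_rows_index)

lemma dim_kets [simp]:
  "dim_row ket0 = 2" "dim_col ket0 = 1" "dim_row ket1 = 2" "dim_col ket1 = 1"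
  "dim_row ket_plus = 2" "dim_col ket_plus = 1" "dim_row ket_minus = 2" "dim_col ket_minus = 1"
  by (simp_all add: ket0_def ket1_def ket_plus_def ket_minus_def mat_of_rows_list_def)

lemma dim_interp_gen:
  "dim_row (interp_gen x) = 2 ^ snd (rg_arity x) \<and> dim_col (interp_gen x) = 2 ^ fst (rg_arity x)"
  by (cases x rule: interp_gen.cases) simp_all

lemma dim_interp [simp]:
  "dim_row (interp f) = 2 ^ tgt rg_arity f" "dim_col (interp f) = 2 ^ src rg_arity f"
  by (induction f) (simp_all add: dim_interp_gen power_add swap_mat_def)

lemma mat_adjoint_kron: "mat_adjoint (kron A B) = kron (mat_adjoint A) (mat_adjoint B)"
  by (rule eq_matI)
     (simp_all add: less_mult_imp_div_less mod_less_of_less_mult)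

lemma perm_mat_swap_index_1: "perm_mat (Suc 0) (swap_index (Suc 0) (Suc 0)) = 1\<^sub>m (Suc 0)"
  by (rule eq_matI) (simp_all add: swap_index_def)

text \<open>
  For a column vector, naturality of the symmetry turns the swap of two copies into the swap of two
  scalars, which is the one-by-one identity.  The same holds for row vectors.
\<close>

lemma swap_mult_kron_ket:
  assumes "dim_row v = 2" and "dim_col v = 1"
  shows "swap_mat 1 1 * kron v v = kron v v"
  using swap_natural_mat[of v 2 1 v 2 1] assms
  by (simp add: swap_mat_eq_perm_mat perm_mat_swap_index_1 right_mult_one_mat')

lemma kron_bra_mult_swap:
  assumes "dim_row v = 2" and "dim_col v = 1"
  shows "bra (kron v v) * swap_mat 1 1 = bra (kron v v)"
  using swap_natural_mat[of "bra v" 1 2 "bra v" 1 2] assms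
  by (simp add: mat_adjoint_kron swap_mat_eq_perm_mat perm_mat_swap_index_1 left_mult_one_mat')

lemma dim_swap_mat [simp]:
  "dim_row (swap_mat m n) = 2 ^ (n + m)" "dim_col (swap_mat m n) = 2 ^ (m + n)"
  by (simp_all add: swap_mat_def)

text \<open>
  Both colours interpret the (co)multiplication by the same expression in an orthonormal basis, the
  computational one for green and the plus-minus one for red; the leg rule needs only the shape of
  that expression.
\<close>

lemma swap_mult_copy:
  assumes "dim_row u = 2" "dim_col u = 1" "dim_row v = 2" "dim_col v = 1"
  shows "swap_mat 1 1 * (kron u u * bra u + kron v v * bra v) = kron u u * bra u + kron v v * bra v"
proof -
  have "swap_mat 1 1 * (kron w w * bra w) = kron w w * bra w"
    if "dim_row w = 2" "dim_col w = 1" for w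
  proof -
    have "swap_mat 1 1 * (kron w w * bra w) = (swap_mat 1 1 * kron w w) * bra w"
      using that by (intro assoc_mult_mat[symmetric, of _ 4 4 _ 1 _ 2] carrier_matI) simp_all
    then show ?thesis by (simp only: swap_mult_kron_ket[OF that])
  qed
  then show ?thesis
    using assms by (subst mult_add_distrib_mat[of _ 4 4 _ 2]) (auto intro!: carrier_matI)
qed

lemma merge_mult_swap:
  assumes "dim_row u = 2" "dim_col u = 1" "dim_row v = 2" "dim_col v = 1"
  shows "(u * bra (kron u u) + v * bra (kron v v)) * swap_mat 1 1
    = u * bra (kron u u) + v * bra (kron v v)"
proof -
  have "(w * bra (kron w w)) * swap_mat 1 1 = w * bra (kron w w)"
    if "dim_row w = 2" "dim_col w = 1" for w
  proof -
    have "(w * bra (kron w w)) * swap_mat 1 1 = w * (bra (kron w w) * swap_mat 1 1)"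
      using that by (intro assoc_mult_mat[of _ 2 1 _ 4 _ 4] carrier_matI) simp_all
    then show ?thesis by (simp only: kron_bra_mult_swap[OF that])
  qed
  then show ?thesis
    using assms by (subst add_mult_distrib_mat[of _ 2 4 _ _ 4]) (auto intro!: carrier_matI)
qed

lemma interp_legs:
  assumes "legs_rel Sp f g"
  shows "interp f = interp g"
  using assms
proof cases
  case (1 c)
  then show ?thesis
    using merge_mult_swap[of ket0 ket1] merge_mult_swap[of ket_plus ket_minus]
    by (cases c) simp_all
next
  case (2 c)
  then show ?thesis
    using swap_mult_copy[of ket0 ket1] swap_mult_copy[of ket_plus ket_minus]
    by (cases c) simp_all
qed

lemma interp_rg_graph_eq:
  assumes "rg_graph_eq f g"
  shows "interp f = interp g"
  using assms unfolding rg_graph_eq_def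
proof induction
  case (base f g)
  then show ?case by (intro interp_legs)
next
  case (comp_assoc f g h)
  then show ?case
    using assoc_mult_mat[of "interp h" "2 ^ tgt rg_arity h" "2 ^ src rg_arity h"
        "interp g" "2 ^ src rg_arity g" "interp f" "2 ^ src rg_arity f"]
    by (simp add: carrier_matI)
next
  case (comp_id_left f)
  then show ?case by (simp add: right_mult_one_mat')
next
  case (comp_id_right f)
  then show ?case by (simp add: left_mult_one_mat')
next
  case (tens_id m n)
  then show ?case by (simp add: perm_mat_id kron_perm_mat power_add div_mult_mod_eq)
next
  case (interchange f g f' g')
  then show ?case by (simp add: kron_mult)
next
  case (swap_natural f g)
  then show ?case by (simp add: swap_mat_eq_perm_mat swap_natural_mat)
next
  case (swap_hexagon m n p)
  then show ?case by (simp add: swap_mat_hexagon)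
qed (simp_all add: kron_assoc swap_mat_inverse swap_mat_unit)

section \<open>The Euler decomposition of the Hadamard matrix\<close>

abbreviation mat2 :: "complex \<Rightarrow> complex \<Rightarrow> complex \<Rightarrow> complex \<Rightarrow> complex mat" where
  "mat2 a b c d \<equiv> mat_of_rows_list 2 [[a, b], [c, d]]"

lemma mat2_eqI:
  assumes "dim_row A = 2" "dim_col A = 2"
    and "A $$ (0, 0) = a" "A $$ (0, 1) = b" "A $$ (1, 0) = c" "A $$ (1, 1) = d"
  shows "A = mat2 a b c d"
proof (rule eq_matI, goal_cases)
  case (1 i j)
  then have "i = 0 \<or> i = 1" "j = 0 \<or> j = 1" by (auto simp: mat_of_rows_list_def)
  then show ?case using assms(3-) by (auto simp: mat_of_rows_list_def)
qed (use assms in \<open>simp_all add: mat_of_rows_list_def\<close>)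

lemma ket_eqI:
  assumes "dim_row A = 2" "dim_col A = 1" and "A $$ (0, 0) = a" "A $$ (1, 0) = b"
  shows "A = mat_of_rows_list 1 [[a], [b]]"
proof (rule eq_matI, goal_cases)
  case (1 i j)
  then have "i = 0 \<or> i = 1" "j = 0" by (auto simp: mat_of_rows_list_def)
  then show ?case using assms(3-) by (auto simp: mat_of_rows_list_def)
qed (use assms in \<open>simp_all add: mat_of_rows_list_def\<close>)

lemma mat2_mult: "mat2 a b c d * mat2 a' b' c' d'
    = mat2 (a * a' + b * c') (a * b' + b * d') (c * a' + d * c') (c * b' + d * d')"
  by (rule mat2_eqI) (simp_all add: mat_of_rows_list_def scalar_prod_def numeral_2_eq_2)

lemma mat2_add: "mat2 a b c d + mat2 a' b' c' d' = mat2 (a + a') (b + b') (c + c') (d + d')"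
  by (rule mat2_eqI) (simp_all add: mat_of_rows_list_def)

lemma mat2_smult: "z \<cdot>\<^sub>m mat2 a b c d = mat2 (z * a) (z * b) (z * c) (z * d)"
  by (rule mat2_eqI) (simp_all add: mat_of_rows_list_def)

lemma mat2_uminus: "- mat2 a b c d = mat2 (- a) (- b) (- c) (- d)"
  by (rule mat2_eqI) (simp_all add: mat_of_rows_list_def)

lemma mat2_one: "1\<^sub>m 2 = mat2 1 0 0 1"
  by (rule mat2_eqI) simp_all

lemma mat2_adjoint: "mat_adjoint (mat2 a b c d) = mat2 (cnj a) (cnj c) (cnj b) (cnj d)"
  by (rule mat2_eqI) (simp_all add: mat_of_rows_list_def)

lemma ket_bra: "mat_of_rows_list 1 [[a], [b]] * bra (mat_of_rows_list 1 [[c], [d]])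
    = mat2 (a * cnj c) (a * cnj d) (b * cnj c) (b * cnj d)"
  by (rule mat2_eqI) (simp_all add: mat_of_rows_list_def scalar_prod_def)

definition inv_sqrt2 :: complex where
  "inv_sqrt2 = complex_of_real (1 / sqrt 2)"

lemma inv_sqrt2_square [simp]: "inv_sqrt2 * inv_sqrt2 = 1 / 2"
proof -
  have "inv_sqrt2 * inv_sqrt2 = complex_of_real (1 / sqrt 2 * (1 / sqrt 2))"
    unfolding inv_sqrt2_def by (rule of_real_mult[symmetric])
  also have "1 / sqrt 2 * (1 / sqrt 2) = (1 / 2 :: real)" by simp
  finally show ?thesis by simp
qed

lemma cnj_inv_sqrt2 [simp]: "cnj inv_sqrt2 = inv_sqrt2"
  by (simp add: inv_sqrt2_def)

lemma inv_sqrt2_nonzero [simp]: "inv_sqrt2 \<noteq> 0"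
  by (simp add: inv_sqrt2_def)

lemma ket_plus_eq: "ket_plus = mat_of_rows_list 1 [[inv_sqrt2], [inv_sqrt2]]"
  and ket_minus_eq: "ket_minus = mat_of_rows_list 1 [[inv_sqrt2], [- inv_sqrt2]]"
  by (rule ket_eqI;
      simp add: ket_plus_def ket_minus_def ket0_def ket1_def mat_of_rows_list_def inv_sqrt2_def)+

lemma smult_inverse_smult:
  fixes z :: complex
  assumes "z \<noteq> 0"
  shows "inverse z \<cdot>\<^sub>m (z \<cdot>\<^sub>m A) = A"
  using assms by (intro eq_matI) (simp_all flip: mult.assoc)

lemma phase_factor_1: "phase_factor 1 = \<i>"
proof -
  have "Rep_bit0 (1 :: phase) = 1" by (rule bit0.Rep_1)
  then show ?thesis
    using cis_pi_half by (simp add: phase_factor_def cis_conv_exp)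
qed

lemmas interp_mat2 = interp.simps(3) interp_gen.simps ket_plus_eq ket_minus_eq ket0_def ket1_def
  ket_bra mat2_add mat2_smult phase_factor_1

lemma interp_had: "interp (Gen Had) = mat2 inv_sqrt2 inv_sqrt2 inv_sqrt2 (- inv_sqrt2)"
  unfolding interp_mat2 by simp

lemma interp_green_1: "interp (Gen (Sp (Phase Gn 1))) = mat2 1 0 0 \<i>"
  unfolding interp_mat2 by simp

lemma interp_red_1: "interp (Gen (Sp (Phase Rd 1)))
    = mat2 ((1 + \<i>) / 2) ((1 - \<i>) / 2) ((1 - \<i>) / 2) ((1 + \<i>) / 2)"
  unfolding interp_mat2 by (simp add: add_divide_distrib diff_divide_distrib)

lemma interp_euler:
  "interp (Gen (Sp (Phase Gn 1)) ;; Gen (Sp (Phase Rd 1)) ;; Gen (Sp (Phase Gn 1)))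
    = ((1 + \<i>) * inv_sqrt2) \<cdot>\<^sub>m interp (Gen Had)"
  unfolding interp.simps(4) interp_green_1 interp_red_1 interp_had mat2_mult mat2_smult
  by (rule arg_cong[of _ _ "mat_of_rows_list 2"])
     (simp add: mult.assoc algebra_simps add_divide_distrib diff_divide_distrib)

text \<open>Conjugation by the Hadamard matrix exchanges the Paulis X and Z and negates Y.\<close>

lemma clifford1_had: "clifford1 (interp (Gen Had))"
proof -
  let ?H = "mat2 inv_sqrt2 inv_sqrt2 inv_sqrt2 (- inv_sqrt2)"
  have adj: "mat_adjoint ?H = ?H" unfolding mat2_adjoint by simp
  have "?H * ?H = 1\<^sub>m 2" unfolding mat2_mult mat2_one by simp
  moreover have "?H * mat2 0 1 1 0 * ?H = mat2 1 0 0 (- 1)"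
    "?H * mat2 1 0 0 (- 1) * ?H = mat2 0 1 1 0"
    "?H * mat2 0 (- \<i>) \<i> 0 * ?H = - mat2 0 (- \<i>) \<i> 0"
    unfolding mat2_mult mat2_uminus by (simp_all add: mult.assoc)
  moreover have "?H \<in> carrier_mat 2 2" by (intro carrier_matI) (simp_all add: mat_of_rows_list_def)
  ultimately show ?thesis
    unfolding clifford1_def interp_had adj pauli_def by blast
qed

theorem lemma6p1:
  fixes f g :: rg
  assumes "euler f g"
  shows "rgb_eq (translate f) (translate g) \<and>
         stab_eq (src rg_arity f) (tgt rg_arity f) (interp f) (interp g)"
proof
  let ?w = "(1 + \<i>) * inv_sqrt2"
  let ?e = "Gen (Sp (Phase Gn 1)) ;; Gen (Sp (Phase Rd 1)) ;; Gen (Sp (Phase Gn 1))"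
  have f: "rg_graph_eq f (Gen Had)" and g: "rg_graph_eq g ?e"
    using assms by (simp_all add: euler_def)
  have "translate (Gen Had) = translate ?e" by simp
  with rgb_eq_translate[OF f] rgb_eq_translate[OF g]
  show "rgb_eq (translate f) (translate g)"
    unfolding rgb_eq_def by (metis presented_eq.sym presented_eq.trans)
  have type: "src rg_arity f = 1" "tgt rg_arity f = 1"
    using presented_eq_typed[OF f[unfolded rg_graph_eq_def]] by simp_all
  have "1 + \<i> \<noteq> 0" by (simp add: complex_eq_iff)
  then have w: "?w \<noteq> 0" by simp
  have had: "stab 1 1 (interp (Gen Had))"
    using clifford1_had by (rule stab.clifford)
  have f': "interp f = interp (Gen Had)" and g': "interp g = ?w \<cdot>\<^sub>m interp (Gen Had)"
    using interp_rg_graph_eq[OF f] interp_rg_graph_eq[OF g] interp_euler by simp_all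
  have "interp f = inverse ?w \<cdot>\<^sub>m interp g"
    unfolding f' g' using w by (rule smult_inverse_smult[symmetric])
  moreover have "inverse ?w \<noteq> 0" using w by simp
  moreover have "stab 1 1 (interp f)" "stab 1 1 (interp g)"
    unfolding f' g' using had w by (auto intro: stab.scale)
  ultimately show "stab_eq (src rg_arity f) (tgt rg_arity f) (interp f) (interp g)"
    unfolding stab_eq_def type by blast
qed

end
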